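(* Let $G$ be a group and let $H$ be a normal, locally noetherian, torsion-free subgroup of finite index in $G$. Suppose that the set $T(G)$ of elements of finite order of $G$ is a subgroup of $G$. If $G/H$ is a UT-group, then $G$ is also a UT-group.
   Context: A group is locally noetherian if each of its finitely generated subgroups is noetherian (satisfies the maximal condition on subgroups). For a group $G$, $\mathcal{U}_1(\mathbb{Z}G)$ denotes the group of units of augmentation one of the integral group ring $\mathbb{Z}G$. For $\alpha=\sum_{h\in G}\alpha(h)h\in\mathbb{Z}G$ and $g\in G$, let $C_g$ be the conjugacy class of $g$ in $G$ and set $\tilde{\alpha}(g)=\sum_{h\in C_g}\alpha(h)$. A unit $\alpha\in\mathcal{U}_1(\mathbb{Z}G)$ has the unique trace property if there exists an element $g\in G$, unique up to conjugacy in $G$, such that $\tilde{\alpha}(g)\neq 0$. A group $G$ is a UT-group (has the UT-property) if every element of finite order of $\mathcal{U}_1(\mathbb{Z}G)$ has the unique trace property. *)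

theory Defs
  imports "HOL-Algebra.Algebra" "HOL-Library.Poly_Mapping"
begin

section \<open>Maximal condition and elements of finite order\<close>

definition noetherian_group :: "('a, 'b) monoid_scheme \<Rightarrow> bool" where
  "noetherian_group G \<longleftrightarrow>
     (\<forall>S. S \<subseteq> {K. subgroup K G} \<and> S \<noteq> {} \<longrightarrow>
        (\<exists>M\<in>S. \<forall>K\<in>S. M \<subseteq> K \<longrightarrow> K = M))"

definition locally_noetherian :: "('a, 'b) monoid_scheme \<Rightarrow> bool" where
  "locally_noetherian G \<longleftrightarrow>
     (\<forall>A. finite A \<and> A \<subseteq> carrier G \<longrightarrow> noetherian_group (G\<lparr>carrier := generate G A\<rparr>))"

definition torsion_elements :: "('a, 'b) monoid_scheme \<Rightarrow> 'a set" where
  "torsion_elements G = {x \<in> carrier G. \<exists>n::nat. n > 0 \<and> x [^]\<^bsub>G\<^esub> n = \<one>\<^bsub>G\<^esub>}"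

definition torsion_free :: "('a, 'b) monoid_scheme \<Rightarrow> bool" where
  "torsion_free G \<longleftrightarrow> torsion_elements G = {\<one>\<^bsub>G\<^esub>}"

lemma (in group) torsion_elements_iff_ord:
  "x \<in> torsion_elements G \<longleftrightarrow> x \<in> carrier G \<and> ord x \<noteq> 0"
proof (cases "x \<in> carrier G")
  case True
  have "(\<exists>n::nat. n > 0 \<and> x [^] n = \<one>) \<longleftrightarrow> ord x \<noteq> 0"
    unfolding ord_eq_0 [OF True] by (simp only: neq0_conv) blast
  with True show ?thesis
    unfolding torsion_elements_def by blast
qed (simp add: torsion_elements_def)


section \<open>The integral group ring\<close>

text \<open>
  An element of the integral group ring is a finitely supported integer-valued function whose
  support lies in the carrier. The product is the bilinear extension of the group law.
\<close>

definition group_ring_mult ::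
  "('a, 'b) monoid_scheme \<Rightarrow> ('a \<Rightarrow>\<^sub>0 int) \<Rightarrow> ('a \<Rightarrow>\<^sub>0 int) \<Rightarrow> ('a \<Rightarrow>\<^sub>0 int)" where
  "group_ring_mult G \<alpha> \<beta> =
     frag_extend (\<lambda>x. frag_extend (\<lambda>y. frag_of (x \<otimes>\<^bsub>G\<^esub> y)) \<beta>) \<alpha>"

definition integral_group_ring :: "('a, 'b) monoid_scheme \<Rightarrow> ('a \<Rightarrow>\<^sub>0 int) ring" where
  "integral_group_ring G =
     \<lparr>carrier = {\<alpha>. Poly_Mapping.keys \<alpha> \<subseteq> carrier G},
      monoid.mult = group_ring_mult G, monoid.one = frag_of \<one>\<^bsub>G\<^esub>,
      ring.zero = 0, ring.add = (+)\<rparr>"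

definition augmentation :: "('a \<Rightarrow>\<^sub>0 int) \<Rightarrow> int" where
  "augmentation \<alpha> = (\<Sum>h\<in>Poly_Mapping.keys \<alpha>. Poly_Mapping.lookup \<alpha> h)"

definition normalized_units :: "('a, 'b) monoid_scheme \<Rightarrow> ('a \<Rightarrow>\<^sub>0 int) monoid" where
  "normalized_units G =
     (units_of (integral_group_ring G))
       \<lparr>carrier := {\<alpha> \<in> Units (integral_group_ring G). augmentation \<alpha> = 1}\<rparr>"

lemma group_ring_mult_of [simp]:
  "group_ring_mult G (frag_of x) (frag_of y) = frag_of (x \<otimes>\<^bsub>G\<^esub> y)"
  by (simp add: group_ring_mult_def)

lemma frag_extend_fun_diff:
  "frag_extend (\<lambda>x. f x - g x) c = frag_extend f c - frag_extend g c"
  by (induction c rule: frag_induction [OF subset_UNIV]) (auto simp: frag_extend_diff)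

lemma group_ring_mult_diff_left:
  "group_ring_mult G (\<alpha> - \<beta>) \<gamma> = group_ring_mult G \<alpha> \<gamma> - group_ring_mult G \<beta> \<gamma>"
  by (simp add: group_ring_mult_def frag_extend_diff)

lemma group_ring_mult_diff_right:
  "group_ring_mult G \<alpha> (\<beta> - \<gamma>) = group_ring_mult G \<alpha> \<beta> - group_ring_mult G \<alpha> \<gamma>"
  by (simp add: group_ring_mult_def frag_extend_diff frag_extend_fun_diff)

lemma group_ring_mult_0_left [simp]: "group_ring_mult G 0 \<alpha> = 0"
  by (simp add: group_ring_mult_def)

lemma group_ring_mult_0_right [simp]: "group_ring_mult G \<alpha> 0 = 0"
  by (simp add: group_ring_mult_def frag_extend_eq_0)

lemma group_ring_mult_add_left:
  "group_ring_mult G (\<alpha> + \<beta>) \<gamma> = group_ring_mult G \<alpha> \<gamma> + group_ring_mult G \<beta> \<gamma>"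
  by (simp add: group_ring_mult_def frag_extend_add)

lemma group_ring_mult_add_right:
  "group_ring_mult G \<alpha> (\<beta> + \<gamma>) = group_ring_mult G \<alpha> \<beta> + group_ring_mult G \<alpha> \<gamma>"
  using group_ring_mult_diff_right [of G \<alpha> "\<beta> + \<gamma>" \<gamma>] by simp

lemma (in group) keys_group_ring_mult:
  assumes "Poly_Mapping.keys \<alpha> \<subseteq> carrier G" "Poly_Mapping.keys \<beta> \<subseteq> carrier G"
  shows "Poly_Mapping.keys (group_ring_mult G \<alpha> \<beta>) \<subseteq> carrier G"
proof -
  have *: "Poly_Mapping.keys (frag_extend (\<lambda>y. frag_of (x \<otimes> y)) \<beta>) \<subseteq> carrier G"
    if "x \<in> carrier G" for x
  proof (rule order_trans [OF keys_frag_extend UN_least])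
    fix y assume "y \<in> Poly_Mapping.keys \<beta>"
    then have "y \<in> carrier G" using assms(2) by (rule rev_subsetD)
    then show "Poly_Mapping.keys (frag_of (x \<otimes> y)) \<subseteq> carrier G" using that by simp
  qed
  show ?thesis
    unfolding group_ring_mult_def
  proof (rule order_trans [OF keys_frag_extend UN_least])
    fix x assume "x \<in> Poly_Mapping.keys \<alpha>"
    then have "x \<in> carrier G" using assms(1) by (rule rev_subsetD)
    then show "Poly_Mapping.keys (frag_extend (\<lambda>y. frag_of (x \<otimes> y)) \<beta>) \<subseteq> carrier G"
      by (rule *)
  qed
qed

lemma (in group) group_ring_mult_assoc:
  assumes a: "Poly_Mapping.keys a \<subseteq> carrier G"
    and b: "Poly_Mapping.keys b \<subseteq> carrier G"
    and c: "Poly_Mapping.keys c \<subseteq> carrier G"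
  shows "group_ring_mult G (group_ring_mult G a b) c = group_ring_mult G a (group_ring_mult G b c)"
  using a
proof (induction a rule: frag_induction)
  case (one x)
  note x = this
  show ?case
    using b
  proof (induction b rule: frag_induction)
    case (one y)
    note y = this
    show ?case
      using c
    proof (induction c rule: frag_induction)
      case (one z)
      then show ?case using x y by (simp add: m_assoc)
    qed (auto simp: group_ring_mult_diff_left group_ring_mult_diff_right)
  qed (auto simp: group_ring_mult_diff_left group_ring_mult_diff_right)
qed (auto simp: group_ring_mult_diff_left group_ring_mult_diff_right)

lemma (in group) group_ring_mult_one_left:
  "Poly_Mapping.keys a \<subseteq> carrier G \<Longrightarrow> group_ring_mult G (frag_of \<one>) a = a"
  by (induction a rule: frag_induction) (auto simp: group_ring_mult_diff_right)

lemma (in group) group_ring_mult_one_right: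
  "Poly_Mapping.keys a \<subseteq> carrier G \<Longrightarrow> group_ring_mult G a (frag_of \<one>) = a"
  by (induction a rule: frag_induction) (auto simp: group_ring_mult_diff_left)

lemma (in group) ring_integral_group_ring: "ring (integral_group_ring G)"
proof (rule ringI)
  show "abelian_group (integral_group_ring G)"
  proof (rule abelian_groupI)
    fix x assume "x \<in> carrier (integral_group_ring G)"
    then show "\<exists>y\<in>carrier (integral_group_ring G).
        y \<oplus>\<^bsub>integral_group_ring G\<^esub> x = \<zero>\<^bsub>integral_group_ring G\<^esub>"
      by (intro bexI [of _ "- x"]) (auto simp: integral_group_ring_def)
  qed (use subset_trans [OF keys_add Un_least] in \<open>simp_all add: integral_group_ring_def add_ac\<close>)
  show "Group.monoid (integral_group_ring G)"
    by (rule monoidI)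
      (simp_all add: integral_group_ring_def keys_group_ring_mult group_ring_mult_assoc
        group_ring_mult_one_left group_ring_mult_one_right)
qed (simp_all add: integral_group_ring_def group_ring_mult_add_left group_ring_mult_add_right)

lemma augmentation_diff: "augmentation (a - b) = augmentation a - augmentation b"
proof -
  have *: "augmentation c = (\<Sum>h\<in>S. Poly_Mapping.lookup c h)"
    if "finite S" "Poly_Mapping.keys c \<subseteq> S" for c :: "'a \<Rightarrow>\<^sub>0 int" and S
    unfolding augmentation_def using that
    by (intro sum.mono_neutral_left) (auto simp: in_keys_iff)
  let ?S = "Poly_Mapping.keys a \<union> Poly_Mapping.keys b"
  have "Poly_Mapping.keys (a - b) \<subseteq> ?S" by (rule keys_diff)
  then show ?thesis
    by (simp add: * [of ?S] lookup_minus sum_subtractf)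
qed

lemma augmentation_0 [simp]: "augmentation 0 = 0"
  by (simp add: augmentation_def)

lemma augmentation_of [simp]: "augmentation (frag_of x) = 1"
  by (simp add: augmentation_def)

lemma augmentation_mult:
  "augmentation (group_ring_mult G a b) = augmentation a * augmentation b"
proof (induction a rule: frag_induction [OF subset_UNIV])
  case (2 x)
  show ?case
    by (induction b rule: frag_induction [OF subset_UNIV])
      (auto simp: group_ring_mult_diff_right augmentation_diff)
qed (auto simp: group_ring_mult_diff_left augmentation_diff algebra_simps)

lemma (in group) group_normalized_units: "group (normalized_units G)"
proof -
  interpret R: ring "integral_group_ring G" by (rule ring_integral_group_ring)
  have m: "x \<otimes>\<^bsub>integral_group_ring G\<^esub> y = group_ring_mult G x y" for x y
    by (simp add: integral_group_ring_def)
  have mult: "augmentation (x \<otimes>\<^bsub>integral_group_ring G\<^esub> y) = augmentation x * augmentation y"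
    for x y
    by (simp add: m augmentation_mult)
  have one: "augmentation \<one>\<^bsub>integral_group_ring G\<^esub> = 1"
    by (simp add: integral_group_ring_def)
  have inv: "augmentation (inv\<^bsub>integral_group_ring G\<^esub> x) = 1"
    if "x \<in> Units (integral_group_ring G)" "augmentation x = 1" for x
    using that one augmentation_mult [of G "inv\<^bsub>integral_group_ring G\<^esub> x" x]
      R.Units_l_inv [OF that(1)] by (simp add: m)
  have "subgroup {\<alpha> \<in> Units (integral_group_ring G). augmentation \<alpha> = 1}
          (units_of (integral_group_ring G))"
    by (rule group.subgroupI [OF R.units_group])
      (use one inv mult in \<open>auto simp: units_of_carrier units_of_mult R.units_of_inv\<close>)
  then show ?thesis
    unfolding normalized_units_def by (rule subgroup.subgroup_is_group [OF _ R.units_group])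
qed


section \<open>Unique trace property\<close>

definition conjugacy_class :: "('a, 'b) monoid_scheme \<Rightarrow> 'a \<Rightarrow> 'a set" where
  "conjugacy_class G g = {x \<otimes>\<^bsub>G\<^esub> g \<otimes>\<^bsub>G\<^esub> inv\<^bsub>G\<^esub> x |x. x \<in> carrier G}"

text \<open>
  A conjugacy class may be infinite, and a sum over an infinite set is \<open>0\<close> by convention,
  hence the intersection with the (finite) support.
\<close>

definition partial_augmentation :: "('a, 'b) monoid_scheme \<Rightarrow> ('a \<Rightarrow>\<^sub>0 int) \<Rightarrow> 'a \<Rightarrow> int" where
  "partial_augmentation G \<alpha> g =
     (\<Sum>h\<in>conjugacy_class G g \<inter> Poly_Mapping.keys \<alpha>. Poly_Mapping.lookup \<alpha> h)"

definition unique_trace :: "('a, 'b) monoid_scheme \<Rightarrow> ('a \<Rightarrow>\<^sub>0 int) \<Rightarrow> bool" where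
  "unique_trace G \<alpha> \<longleftrightarrow>
     (\<exists>g\<in>carrier G. partial_augmentation G \<alpha> g \<noteq> 0 \<and>
        (\<forall>h\<in>carrier G. partial_augmentation G \<alpha> h \<noteq> 0 \<longrightarrow> h \<in> conjugacy_class G g))"

definition UT_group :: "('a, 'b) monoid_scheme \<Rightarrow> bool" where
  "UT_group G \<longleftrightarrow> group G \<and> (\<forall>\<alpha>\<in>torsion_elements (normalized_units G). unique_trace G \<alpha>)"

end

theory Submission
  imports Defs "HOL-Number_Theory.Residues"
begin

text \<open>
  Let \<open>\<alpha>\<close> be a unit with \<open>\<alpha>\<^sup>n = 1\<close> and let \<open>q = p\<^sup>k\<close> be a power of a large prime with
  \<open>q \<equiv> 1\<close> modulo \<open>n\<close>, so that \<open>\<alpha>\<^sup>q = \<alpha>\<close>. Expanding \<open>\<alpha>\<^sup>q\<close> over words of length \<open>q\<close>, cyclic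
  rotation changes the product of a word only by conjugation, so modulo \<open>p\<close> only the constant
  words contribute to a partial augmentation. Hence every class with nonzero partial augmentation
  is the \<open>q\<close>-th power of another such class, and by finiteness it contains a power of some \<open>h\<close>
  conjugate to \<open>h\<^sup>t\<close>, \<open>t > 1\<close>. Passing to powers lying in \<open>H\<close>, the iterated conjugates of a
  cyclic group form an ascending chain, whose stabilisation makes \<open>h\<close> torsion. So only torsion
  classes have nonzero partial augmentation. Since torsion elements form a subgroup meeting \<open>H\<close>
  trivially, distinct torsion classes stay distinct in \<open>G/H\<close>, and the unique trace property
  is inherited from the image of \<open>\<alpha>\<close> in the group ring of \<open>G/H\<close>.
\<close>

section \<open>Sums over orbits of prime power period\<close>

text \<open>An orbit of \<open>r\<close> in \<open>S\<close> has length dividing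
  \<open>p ^ k\<close>, so length 1 or a multiple of \<open>p\<close>. As \<open>f\<close> is
  constant on it, a longer orbit contributes 0 modulo \<open>p\<close>. The induction removes one
  such orbit at a time.\<close>

lemma sum_cong_sum_fixed_points:
  fixes f :: "'a \<Rightarrow> int" and r :: "'a \<Rightarrow> 'a"
  assumes "finite S" and p: "Factorial_Ring.prime p"
    and "\<And>x. x \<in> S \<Longrightarrow> r x \<in> S"
    and "\<And>x. x \<in> S \<Longrightarrow> (r ^^ (p ^ k)) x = x"
    and "\<And>x. x \<in> S \<Longrightarrow> f (r x) = f x"
  shows "[sum f S = sum f {x \<in> S. r x = x}] (mod int p)"
  using assms(1,3-)
proof (induction S rule: finite_psubset_induct)
  case (psubset S)
  note r_in = psubset.prems(1) and period = psubset.prems(2) and f_r = psubset.prems(3)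
  show ?case
  proof (cases "\<forall>x\<in>S. r x = x")
    case True
    then have "{x \<in> S. r x = x} = S" by auto
    then show ?thesis by simp
  next
    case False
    then obtain x where x: "x \<in> S" "r x \<noteq> x" by blast
    define q where "q = p ^ k"
    have q: "q > 0" using p by (simp add: q_def prime_gt_0_nat)
    have pow_in: "(r ^^ i) y \<in> S" if "y \<in> S" for i y
      using that by (induction i) (auto intro: r_in)
    have f_pow: "f ((r ^^ i) y) = f y" if "y \<in> S" for i y
      using that by (induction i) (auto simp: f_r pow_in)
    define d where "d = (LEAST d. d > 0 \<and> (r ^^ d) x = x)"
    have d: "d > 0" "(r ^^ d) x = x"
      using LeastI [of "\<lambda>d. d > 0 \<and> (r ^^ d) x = x" q] q period [OF x(1)]
      by (auto simp: d_def q_def)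
    have d_least: "d \<le> e" if "e > 0" "(r ^^ e) x = x" for e
      unfolding d_def using that by (intro Least_le) auto
    \<comment> \<open>The remainder \<open>q mod d\<close> is again a period of \<open>x\<close>, so
      minimality of \<open>d\<close> forces it to be 0.\<close>
    have "(r ^^ (q mod d)) x = x"
      using funpow_mod_eq [OF d(2), of q] period [OF x(1)] by (simp add: q_def)
    then have "d dvd q"
      using d_least [of "q mod d"] d(1) by (metis dvd_eq_mod_eq_0 gr0I mod_less_divisor not_le)
    moreover have "d \<noteq> 1" using d(2) x(2) by auto
    ultimately have pd: "p dvd d"
      unfolding q_def divides_primepow_nat [OF p] by (metis dvd_power gr0I power_0)
    define Z where "Z = (\<lambda>i. (r ^^ i) x) ` {..<d}"
    have inj: "inj_on (\<lambda>i. (r ^^ i) x) {..<d}"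
    proof (rule linorder_inj_onI)
      fix i j assume ij: "i < j" "i \<in> {..<d}" "j \<in> {..<d}"
      show "(r ^^ i) x \<noteq> (r ^^ j) x"
      proof
        assume "(r ^^ i) x = (r ^^ j) x"
        then have "(r ^^ (d - j)) ((r ^^ i) x) = (r ^^ (d - j)) ((r ^^ j) x)" by simp
        then have "(r ^^ (d - j + i)) x = (r ^^ (d - j + j)) x" by (simp only: funpow_add o_apply)
        then have "(r ^^ (d - j + i)) x = x" using ij d by simp
        then show False using d_least [of "d - j + i"] ij by auto
      qed
    qed auto
    have Z_sub: "Z \<subseteq> S" using pow_in [OF x(1)] by (auto simp: Z_def)
    have x_Z: "x \<in> Z" unfolding Z_def using d(1) by (intro image_eqI [of _ _ 0]) auto
    have Z_eq: "(r ^^ i) x \<in> Z" for i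
      unfolding Z_def using funpow_mod_eq [OF d(2), of i] d(1)
      by (intro image_eqI [of _ _ "i mod d"]) auto
    \<comment> \<open>On \<open>S\<close> the map \<open>r ^^ (q - 1)\<close> inverts
      \<open>r\<close>. Hence nothing outside the orbit \<open>Z\<close> is mapped into it, and the
      induction hypothesis applies to \<open>S - Z\<close>.\<close>
    have undo: "(r ^^ (q - 1)) (r y) = y" if "y \<in> S" for y
    proof -
      have "(r ^^ (q - 1)) (r y) = (r ^^ Suc (q - 1)) y" by (simp only: funpow_Suc_right o_apply)
      also have "\<dots> = y" using q period [OF that] by (simp add: q_def)
      finally show ?thesis .
    qed
    have out: "r y \<notin> Z" if "y \<in> S - Z" for y
    proof
      assume "r y \<in> Z"
      then obtain i where "r y = (r ^^ i) x" by (auto simp: Z_def)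
      then have "y = (r ^^ (q - 1 + i)) x" using undo [of y] that by (simp add: funpow_add)
      then show False using Z_eq that by auto
    qed
    have no_fix: "r y \<noteq> y" if "y \<in> Z" for y
    proof
      assume y: "r y = y"
      from that obtain i where i: "y = (r ^^ i) x" "i < d" by (auto simp: Z_def)
      have "(r ^^ n) y = y" for n by (induction n) (auto simp: y)
      moreover have "(r ^^ (d - i)) y = x"
      proof -
        have "(r ^^ (d - i)) y = (r ^^ (d - i + i)) x" unfolding i by (simp only: funpow_add o_apply)
        then show ?thesis using i d by simp
      qed
      ultimately show False using y x by simp
    qed
    have "[sum f (S - Z) = sum f {x \<in> S - Z. r x = x}] (mod int p)"
      by (rule psubset.IH) (use x x_Z r_in period f_r out in auto)
    moreover have "{x \<in> S - Z. r x = x} = {x \<in> S. r x = x}" using no_fix by auto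
    moreover have "sum f S = sum f (S - Z) + sum f Z"
      by (rule sum.subset_diff [OF Z_sub psubset.hyps(1)])
    moreover have "sum f Z = int d * f x"
      unfolding Z_def using inj f_pow [OF x(1)] by (simp add: sum.reindex)
    ultimately show ?thesis
      using pd by (auto simp: cong_def mod_add_eq [symmetric])
  qed
qed

text \<open>Fermat's little theorem, iterated \<open>k\<close> times.\<close>

lemma int_pow_prime_power_cong:
  fixes a :: int
  assumes p: "Factorial_Ring.prime p"
  shows "[a ^ (p ^ k) = a] (mod int p)"
proof -
  have fermat: "[b ^ p = b] (mod int p)" for b :: int
  proof -
    \<comment> \<open>\<open>fermat_theorem\<close> is applied to naturals, so \<open>b\<close> is
      replaced by its residue.\<close>
    define c where "c = nat (b mod int p)"
    have p0: "p > 0" using p by (simp add: prime_gt_0_nat)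
    have c: "int c = b mod int p" using p0 by (simp add: c_def)
    have "[c ^ p = c] (mod p)"
    proof (cases "p dvd c")
      case True
      then have "p dvd c ^ p" using p0 by (meson dvd_power dvd_trans)
      with True show ?thesis by (metis cong_0_iff cong_sym cong_trans)
    next
      case False
      have "[c ^ (p - 1) * c = 1 * c] (mod p)"
        by (rule cong_mult [OF fermat_theorem [OF p False]]) simp
      then show ?thesis using p0 by (metis Suc_pred' mult.commute mult_1 power_Suc)
    qed
    then have "[int c ^ p = int c] (mod int p)" by (metis cong_int_iff of_nat_power)
    moreover have "[b = int c] (mod int p)" by (simp add: c cong_def)
    ultimately show ?thesis by (meson cong_pow cong_sym cong_trans)
  qed
  show ?thesis
  proof (induction k)
    case (Suc k)
    have "[(a ^ (p ^ k)) ^ p = a ^ (p ^ k)] (mod int p)" by (rule fermat)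
    also have "[a ^ (p ^ k) = a] (mod int p)" by (rule Suc)
    finally show ?case by (simp add: power_mult [symmetric] mult.commute)
  qed simp
qed


section \<open>Linear functionals on the group ring\<close>

text \<open>The additive extension of \<open>\<phi>\<close> to formal sums. Augmentation and partial
  augmentations are instances, so comparing them reduces to comparing functions on the
  group.\<close>

definition pairing :: "('a \<Rightarrow> int) \<Rightarrow> ('a \<Rightarrow>\<^sub>0 int) \<Rightarrow> int" where
  "pairing \<phi> \<alpha> = (\<Sum>h\<in>Poly_Mapping.keys \<alpha>. Poly_Mapping.lookup \<alpha> h * \<phi> h)"

lemma pairing_0 [simp]: "pairing \<phi> 0 = 0"
  and pairing_of [simp]: "pairing \<phi> (frag_of x) = \<phi> x"
  by (simp_all add: pairing_def)

lemma pairing_fun_diff: "pairing (\<lambda>h. \<phi> h - \<psi> h) \<alpha> = pairing \<phi> \<alpha> - pairing \<psi> \<alpha>"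
  by (simp add: pairing_def algebra_simps sum_subtractf)

lemma pairing_diff: "pairing \<phi> (\<alpha> - \<beta>) = pairing \<phi> \<alpha> - pairing \<phi> \<beta>"
proof -
  let ?S = "Poly_Mapping.keys \<alpha> \<union> Poly_Mapping.keys \<beta>"
  have *: "pairing \<phi> c = (\<Sum>h\<in>?S. Poly_Mapping.lookup c h * \<phi> h)"
    if "Poly_Mapping.keys c \<subseteq> ?S" for c
    unfolding pairing_def using that by (intro sum.mono_neutral_left) (auto simp: in_keys_iff)
  show ?thesis
    using keys_diff [of \<alpha> \<beta>] by (simp add: * lookup_minus algebra_simps sum_subtractf)
qed

lemma pairing_group_ring_mult:
  "pairing \<phi> (group_ring_mult G \<alpha> \<beta>) = pairing (\<lambda>g. pairing (\<lambda>h. \<phi> (g \<otimes>\<^bsub>G\<^esub> h)) \<beta>) \<alpha>"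
proof (induction \<alpha> rule: frag_induction [OF subset_UNIV])
  case (2 x)
  show ?case
    by (induction \<beta> rule: frag_induction [OF subset_UNIV])
      (auto simp: group_ring_mult_diff_right pairing_diff)
qed (auto simp: group_ring_mult_diff_left pairing_diff)

lemma augmentation_eq_pairing: "augmentation \<alpha> = pairing (\<lambda>_. 1) \<alpha>"
  by (simp add: augmentation_def pairing_def)

definition class_indicator :: "('a, 'b) monoid_scheme \<Rightarrow> 'a \<Rightarrow> 'a \<Rightarrow> int" where
  "class_indicator G g h = of_bool (h \<in> conjugacy_class G g)"

lemma partial_augmentation_eq_pairing:
  "partial_augmentation G \<alpha> g = pairing (class_indicator G g) \<alpha>"
  unfolding partial_augmentation_def pairing_def class_indicator_def
  by (intro sum.mono_neutral_cong_left) auto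

section \<open>Maps of group rings induced by group homomorphisms\<close>

definition group_ring_map :: "('a \<Rightarrow> 'b) \<Rightarrow> ('a \<Rightarrow>\<^sub>0 int) \<Rightarrow> ('b \<Rightarrow>\<^sub>0 int)" where
  "group_ring_map f = frag_extend (frag_of \<circ> f)"

lemma group_ring_map_of [simp]: "group_ring_map f (frag_of x) = frag_of (f x)"
  and group_ring_map_0 [simp]: "group_ring_map f 0 = 0"
  and group_ring_map_diff: "group_ring_map f (\<alpha> - \<beta>) = group_ring_map f \<alpha> - group_ring_map f \<beta>"
  by (simp_all add: group_ring_map_def frag_extend_diff)

lemma keys_group_ring_map: "Poly_Mapping.keys (group_ring_map f \<alpha>) \<subseteq> f ` Poly_Mapping.keys \<alpha>"
  unfolding group_ring_map_def using keys_frag_extend [of "frag_of \<circ> f" \<alpha>] by auto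

lemma pairing_group_ring_map: "pairing \<phi> (group_ring_map f \<alpha>) = pairing (\<phi> \<circ> f) \<alpha>"
  by (induction \<alpha> rule: frag_induction [OF subset_UNIV])
    (auto simp: group_ring_map_diff pairing_diff)

lemma group_ring_map_mult:
  assumes "f \<in> hom G K" "Poly_Mapping.keys \<alpha> \<subseteq> carrier G" "Poly_Mapping.keys \<beta> \<subseteq> carrier G"
  shows "group_ring_map f (group_ring_mult G \<alpha> \<beta>) =
    group_ring_mult K (group_ring_map f \<alpha>) (group_ring_map f \<beta>)"
  using assms(2)
proof (induction \<alpha> rule: frag_induction)
  case (one x)
  show ?case
    using assms(3)
    by (induction \<beta> rule: frag_induction)
      (use one assms(1) in \<open>auto simp: group_ring_mult_diff_right group_ring_map_diff hom_mult\<close>)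
qed (auto simp: group_ring_mult_diff_left group_ring_map_diff)


section \<open>Torsion units\<close>

lemma normalized_units_simps [simp]:
  "x \<otimes>\<^bsub>normalized_units G\<^esub> y = group_ring_mult G x y"
  "\<one>\<^bsub>normalized_units G\<^esub> = frag_of \<one>\<^bsub>G\<^esub>"
  by (simp_all add: normalized_units_def units_of_def integral_group_ring_def)

lemma carrier_normalized_units:
  "\<alpha> \<in> carrier (normalized_units G) \<longleftrightarrow> augmentation \<alpha> = 1 \<and>
    Poly_Mapping.keys \<alpha> \<subseteq> carrier G \<and>
    (\<exists>\<beta>. Poly_Mapping.keys \<beta> \<subseteq> carrier G \<and> group_ring_mult G \<beta> \<alpha> = frag_of \<one>\<^bsub>G\<^esub> \<and>
      group_ring_mult G \<alpha> \<beta> = frag_of \<one>\<^bsub>G\<^esub>)"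
  by (auto simp: normalized_units_def Units_def integral_group_ring_def)

text \<open>The image of an inverse is an inverse of the image, and the augmentation is the pairing
  with a constant function, which composition with \<open>f\<close> does not change.\<close>

lemma group_ring_map_normalized_units:
  assumes "group G" "group K" "f \<in> hom G K"
  shows "group_ring_map f \<in> hom (normalized_units G) (normalized_units K)"
proof (rule homI)
  fix \<alpha> \<beta> assume "\<alpha> \<in> carrier (normalized_units G)" "\<beta> \<in> carrier (normalized_units G)"
  then show "group_ring_map f (\<alpha> \<otimes>\<^bsub>normalized_units G\<^esub> \<beta>) =
      group_ring_map f \<alpha> \<otimes>\<^bsub>normalized_units K\<^esub> group_ring_map f \<beta>"
    using assms by (simp add: carrier_normalized_units group_ring_map_mult)
next
  fix \<alpha> assume "\<alpha> \<in> carrier (normalized_units G)"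
  then obtain \<beta> where aug: "augmentation \<alpha> = 1"
    and keys: "Poly_Mapping.keys \<alpha> \<subseteq> carrier G" "Poly_Mapping.keys \<beta> \<subseteq> carrier G"
    and inv: "group_ring_mult G \<beta> \<alpha> = frag_of \<one>\<^bsub>G\<^esub>" "group_ring_mult G \<alpha> \<beta> = frag_of \<one>\<^bsub>G\<^esub>"
    by (auto simp: carrier_normalized_units)
  have keys_map: "Poly_Mapping.keys (group_ring_map f c) \<subseteq> carrier K"
    if "Poly_Mapping.keys c \<subseteq> carrier G" for c
    using keys_group_ring_map [of f c] that assms(3) by (auto simp: hom_def Pi_iff)
  have one: "f \<one>\<^bsub>G\<^esub> = \<one>\<^bsub>K\<^esub>" using assms hom_one by blast
  have "augmentation (group_ring_map f \<alpha>) = 1"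
    using aug by (simp add: augmentation_eq_pairing pairing_group_ring_map o_def)
  moreover have "group_ring_mult K (group_ring_map f \<beta>) (group_ring_map f \<alpha>) = frag_of \<one>\<^bsub>K\<^esub>"
    "group_ring_mult K (group_ring_map f \<alpha>) (group_ring_map f \<beta>) = frag_of \<one>\<^bsub>K\<^esub>"
    using keys inv by (simp_all flip: group_ring_map_mult [OF assms(3)] add: one)
  ultimately show "group_ring_map f \<alpha> \<in> carrier (normalized_units K)"
    using keys_map keys by (auto simp: carrier_normalized_units)
qed

lemma hom_torsion_elements:
  assumes "group G" "group K" "f \<in> hom G K" "x \<in> torsion_elements G"
  shows "f x \<in> torsion_elements K"
proof -
  interpret group_hom G K f using assms by (simp add: group_hom_def group_hom_axioms_def)
  show ?thesis
    using assms(4) unfolding torsion_elements_def by (auto simp flip: hom_nat_pow)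
qed

text \<open>Factors are multiplied in reverse list order: the head is the last factor, which matches
  the recursion \<open>x [^] Suc n = x [^] n \<otimes> x\<close>.\<close>

fun word_prod :: "('a, 'b) monoid_scheme \<Rightarrow> 'a list \<Rightarrow> 'a" where
  "word_prod G [] = \<one>\<^bsub>G\<^esub>"
| "word_prod G (x # xs) = word_prod G xs \<otimes>\<^bsub>G\<^esub> x"

text \<open>Multinomial expansion into words. The induction varies \<open>\<phi>\<close>, because
  splitting off the last factor replaces it by \<open>\<lambda>g. pairing (\<lambda>h. \<phi> (g
  \<otimes> h)) \<alpha>\<close>.\<close>

lemma pairing_pow:
  "pairing \<phi> (\<alpha> [^]\<^bsub>normalized_units G\<^esub> (n::nat)) =
    (\<Sum>w\<in>{w. set w \<subseteq> Poly_Mapping.keys \<alpha> \<and> length w = n}.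
      prod_list (map (Poly_Mapping.lookup \<alpha>) w) * \<phi> (word_prod G w))"
proof (induction n arbitrary: \<phi>)
  case (Suc n)
  let ?W = "{w. set w \<subseteq> Poly_Mapping.keys \<alpha> \<and> length w = n}"
  let ?f = "\<lambda>w. prod_list (map (Poly_Mapping.lookup \<alpha>) w) * \<phi> (word_prod G w)"
  have "inj_on (\<lambda>(xs, n). n # xs) (?W \<times> Poly_Mapping.keys \<alpha>)" by (auto simp: inj_on_def)
  then have "(\<Sum>w\<in>{w. set w \<subseteq> Poly_Mapping.keys \<alpha> \<and> length w = Suc n}. ?f w) =
      (\<Sum>w\<in>?W. \<Sum>x\<in>Poly_Mapping.keys \<alpha>. ?f (x # w))"
    unfolding lists_length_Suc_eq
    by (simp add: sum.reindex sum.cartesian_product case_prod_unfold)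
  also have "\<dots> = (\<Sum>w\<in>?W. prod_list (map (Poly_Mapping.lookup \<alpha>) w) *
      pairing (\<lambda>x. \<phi> (word_prod G w \<otimes>\<^bsub>G\<^esub> x)) \<alpha>)"
    by (simp add: pairing_def sum_distrib_left mult_ac)
  finally show ?case
    by (simp add: pairing_group_ring_mult Suc.IH)
next
  case 0
  have "{w. set w \<subseteq> Poly_Mapping.keys \<alpha> \<and> length w = 0} = {[]}" by auto
  then show ?case by simp
qed

section \<open>Conjugacy classes, torsion elements and class functions\<close>

context group
begin

lemma inv_mult_cancel:
  assumes "x \<in> carrier G" "y \<in> carrier G"
  shows "inv x \<otimes> (x \<otimes> y) = y" "x \<otimes> (inv x \<otimes> y) = y"
  using assms by (simp_all flip: m_assoc)

lemma conjugacy_class_carrier: "g \<in> carrier G \<Longrightarrow> conjugacy_class G g \<subseteq> carrier G"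
  by (auto simp: conjugacy_class_def)

lemma conjugacy_class_refl: "g \<in> carrier G \<Longrightarrow> g \<in> conjugacy_class G g"
  by (auto simp: conjugacy_class_def intro!: exI [of _ \<one>])

lemma conjugacy_class_trans:
  assumes "g \<in> carrier G" "h \<in> conjugacy_class G g" "k \<in> conjugacy_class G h"
  shows "k \<in> conjugacy_class G g"
proof -
  from assms obtain x y where "x \<in> carrier G" "y \<in> carrier G"
    "k = y \<otimes> (x \<otimes> g \<otimes> inv x) \<otimes> inv y"
    by (auto simp: conjugacy_class_def)
  with assms(1) show ?thesis
    by (auto simp: conjugacy_class_def inv_mult_group m_assoc intro!: exI [of _ "y \<otimes> x"])
qed

lemma conjugacy_class_sym:
  assumes "g \<in> carrier G" "h \<in> conjugacy_class G g"
  shows "g \<in> conjugacy_class G h"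
proof -
  from assms obtain x where x: "x \<in> carrier G" "h = x \<otimes> g \<otimes> inv x"
    by (auto simp: conjugacy_class_def)
  then have "g = inv x \<otimes> h \<otimes> inv (inv x)"
    using assms(1) by (simp add: m_assoc inv_mult_cancel)
  then show ?thesis using x(1) unfolding conjugacy_class_def by blast
qed

lemma conjugacy_class_eq_iff:
  assumes "g \<in> carrier G" "h \<in> carrier G"
  shows "conjugacy_class G h = conjugacy_class G g \<longleftrightarrow> h \<in> conjugacy_class G g"
  using assms conjugacy_class_refl conjugacy_class_sym conjugacy_class_trans by blast

lemma conjugate_pow:
  assumes "x \<in> carrier G" "g \<in> carrier G"
  shows "(x \<otimes> g \<otimes> inv x) [^] (n::nat) = x \<otimes> g [^] n \<otimes> inv x"
proof (induction n)
  case (Suc n)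
  then show ?case using assms by (simp add: m_assoc inv_mult_cancel)
qed (use assms in simp)

lemma conjugacy_class_pow:
  assumes "g \<in> carrier G" "h \<in> conjugacy_class G g"
  shows "h [^] (n::nat) \<in> conjugacy_class G (g [^] n)"
  using assms by (auto simp: conjugacy_class_def conjugate_pow)

lemma conjugacy_class_mem_cong:
  assumes "g \<in> carrier G" "k \<in> carrier G" "h \<in> conjugacy_class G g"
  shows "h \<in> conjugacy_class G k \<longleftrightarrow> g \<in> conjugacy_class G k"
  using assms conjugacy_class_sym conjugacy_class_trans by blast

lemma conjugacy_class_pow_cong:
  assumes "g \<in> carrier G" "k \<in> carrier G" "h \<in> conjugacy_class G g"
  shows "h [^] (n::nat) \<in> conjugacy_class G k \<longleftrightarrow> g [^] n \<in> conjugacy_class G k"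
  using assms conjugacy_class_pow by (intro conjugacy_class_mem_cong) auto

lemma torsion_elements_pow_iff:
  assumes "x \<in> carrier G" "(n::nat) > 0"
  shows "x [^] n \<in> torsion_elements G \<longleftrightarrow> x \<in> torsion_elements G"
proof
  assume "x [^] n \<in> torsion_elements G"
  then obtain m :: nat where "m > 0" "x [^] (n * m) = \<one>"
    using assms by (auto simp: torsion_elements_def nat_pow_pow)
  then show "x \<in> torsion_elements G"
    using assms unfolding torsion_elements_def by (intro CollectI conjI exI [of _ "n * m"]) auto
next
  assume "x \<in> torsion_elements G"
  then obtain m :: nat where "m > 0" "x [^] m = \<one>" by (auto simp: torsion_elements_def)
  then have "(x [^] n) [^] m = \<one>"
    using assms by (metis nat_pow_pow mult.commute nat_pow_one)
  then show "x [^] n \<in> torsion_elements G"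
    using assms \<open>m > 0\<close> by (auto simp: torsion_elements_def)
qed

lemma conjugacy_class_torsion:
  assumes "g \<in> carrier G" "h \<in> conjugacy_class G g" "h \<in> torsion_elements G"
  shows "g \<in> torsion_elements G"
proof -
  from assms(3) obtain m :: nat where "m > 0" and "h [^] m = \<one>" by (auto simp: torsion_elements_def)
  moreover have "g [^] m \<in> conjugacy_class G (h [^] m)"
    using assms conjugacy_class_carrier conjugacy_class_sym conjugacy_class_pow by blast
  ultimately have "g [^] m = \<one>" by (auto simp: conjugacy_class_def)
  with \<open>m > 0\<close> show ?thesis using assms by (auto simp: torsion_elements_def)
qed

text \<open>Grouping the support by conjugacy classes, the class of \<open>g\<close> contributes
  \<open>partial_augmentation G \<alpha> g * \<psi> g\<close>, and one of the two factors
  vanishes.\<close>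

lemma pairing_class_function:
  assumes keys: "Poly_Mapping.keys \<alpha> \<subseteq> carrier G"
    and \<psi>: "\<And>g h. g \<in> carrier G \<Longrightarrow> h \<in> conjugacy_class G g \<Longrightarrow> \<psi> h = \<psi> g"
    and zero: "\<And>g. g \<in> carrier G \<Longrightarrow> \<psi> g \<noteq> 0 \<Longrightarrow> partial_augmentation G \<alpha> g = 0"
  shows "pairing \<psi> \<alpha> = 0"
proof -
  let ?K = "Poly_Mapping.keys \<alpha>"
  have "pairing \<psi> \<alpha> = (\<Sum>C\<in>conjugacy_class G ` ?K.
      \<Sum>h | h \<in> ?K \<and> conjugacy_class G h = C. Poly_Mapping.lookup \<alpha> h * \<psi> h)"
    unfolding pairing_def by (rule sum.image_gen) simp
  also have "\<dots> = 0"
  proof (rule sum.neutral, safe)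
    fix g assume g: "g \<in> ?K"
    then have gG: "g \<in> carrier G" using keys by auto
    have eq: "{h. h \<in> ?K \<and> conjugacy_class G h = conjugacy_class G g} = conjugacy_class G g \<inter> ?K"
      using keys gG conjugacy_class_eq_iff by blast
    have "(\<Sum>h\<in>conjugacy_class G g \<inter> ?K. Poly_Mapping.lookup \<alpha> h * \<psi> h) =
        partial_augmentation G \<alpha> g * \<psi> g"
      unfolding partial_augmentation_def sum_distrib_right using gG
      by (intro sum.cong) (auto simp: \<psi>)
    also have "\<dots> = 0" using zero [OF gG] by auto
    finally show "(\<Sum>h | h \<in> ?K \<and> conjugacy_class G h = conjugacy_class G g.
        Poly_Mapping.lookup \<alpha> h * \<psi> h) = 0"
      unfolding eq .
  qed
  finally show ?thesis .
qed

section \<open>Partial augmentations of prime power powers\<close>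

lemma word_prod_closed: "set w \<subseteq> carrier G \<Longrightarrow> word_prod G w \<in> carrier G"
  by (induction w) auto

lemma word_prod_snoc:
  "set w \<subseteq> carrier G \<Longrightarrow> x \<in> carrier G \<Longrightarrow> word_prod G (w @ [x]) = x \<otimes> word_prod G w"
  by (induction w) (auto simp: m_assoc word_prod_closed)

lemma word_prod_replicate: "x \<in> carrier G \<Longrightarrow> word_prod G (replicate n x) = x [^] n"
  by (induction n) auto

text \<open>Rotation moves the head \<open>x\<close>, the rightmost factor, to the far left; this is
  conjugation by \<open>x\<close>.\<close>

lemma word_prod_rotate1:
  assumes "set w \<subseteq> carrier G"
  shows "word_prod G (rotate1 w) \<in> conjugacy_class G (word_prod G w)"
proof (cases w)
  case Nil
  then show ?thesis by (simp add: conjugacy_class_refl)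
next
  case (Cons x v)
  then have xv: "x \<in> carrier G" "set v \<subseteq> carrier G" using assms by auto
  then have "x \<otimes> word_prod G v = x \<otimes> (word_prod G v \<otimes> x) \<otimes> inv x"
    by (simp add: m_assoc word_prod_closed)
  then show ?thesis using xv Cons by (auto simp: word_prod_snoc conjugacy_class_def)
qed

text \<open>\<open>sum_cong_sum_fixed_points\<close> is applied to \<open>rotate1\<close> on the
  words of length \<open>p ^ k\<close> in the support: the product of the coefficients and the
  conjugacy class of the word product are invariant under rotation.\<close>

lemma partial_augmentation_pow_cong:
  assumes keys: "Poly_Mapping.keys \<alpha> \<subseteq> carrier G" and x: "x \<in> carrier G"
    and p: "Factorial_Ring.prime p"
  shows "[partial_augmentation G (\<alpha> [^]\<^bsub>normalized_units G\<^esub> (p ^ k)) x =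
    pairing (\<lambda>h. class_indicator G x (h [^] (p ^ k))) \<alpha>] (mod int p)"
proof -
  define q where "q = p ^ k"
  have q: "q > 0" using p by (simp add: q_def prime_gt_0_nat)
  let ?K = "Poly_Mapping.keys \<alpha>"
  let ?W = "{w. set w \<subseteq> ?K \<and> length w = q}"
  let ?f = "\<lambda>w. prod_list (map (Poly_Mapping.lookup \<alpha>) w) * class_indicator G x (word_prod G w)"
  have "partial_augmentation G (\<alpha> [^]\<^bsub>normalized_units G\<^esub> q) x = sum ?f ?W"
    by (simp add: partial_augmentation_eq_pairing pairing_pow)
  also have "[sum ?f ?W = sum ?f {w \<in> ?W. rotate1 w = w}] (mod int p)"
  proof (rule sum_cong_sum_fixed_points [OF _ p])
    show "finite ?W" by (rule finite_lists_length_eq) simp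
  next
    fix w assume "w \<in> ?W"
    then show "rotate1 w \<in> ?W" by simp
  next
    fix w assume "w \<in> ?W"
    then show "(rotate1 ^^ (p ^ k)) w = w"
      by (simp add: q_def flip: rotate_def)
  next
    fix w assume "w \<in> ?W"
    then have w: "set w \<subseteq> carrier G" using keys by auto
    have "prod_list (map (Poly_Mapping.lookup \<alpha>) (rotate1 w)) =
        prod_list (map (Poly_Mapping.lookup \<alpha>) w)"
      by (cases w) (auto simp: mult.commute)
    moreover have "class_indicator G x (word_prod G (rotate1 w)) = class_indicator G x (word_prod G w)"
      using conjugacy_class_mem_cong [OF word_prod_closed [OF w] x word_prod_rotate1 [OF w]]
      by (simp add: class_indicator_def)
    ultimately show "?f (rotate1 w) = ?f w" by simp
  qed
  \<comment> \<open>A word fixed by \<open>rotate1\<close> is empty or constant;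
    \<open>q > 0\<close> excludes the empty one.\<close>
  also have "{w \<in> ?W. rotate1 w = w} = replicate q ` ?K"
  proof (intro equalityI subsetI)
    fix w assume w: "w \<in> {w \<in> ?W. rotate1 w = w}"
    then have "card (set w) = 1" using rotate1_fixpoint_card [of w] q by auto
    then obtain h where h: "set w = {h}" by (auto simp: card_1_singleton_iff)
    then have "w = replicate q h" using w by (auto intro: replicate_eqI)
    then show "w \<in> replicate q ` ?K" using w h by auto
  next
    fix w assume "w \<in> replicate q ` ?K"
    then obtain h where h: "h \<in> ?K" "w = replicate q h" by auto
    have "rotate1 (replicate q h) = replicate q h"
      by (cases q) (auto simp: replicate_append_same)
    then show "w \<in> {w \<in> ?W. rotate1 w = w}" using h by auto
  qed
  also have "sum ?f (replicate q ` ?K) =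
      (\<Sum>h\<in>?K. Poly_Mapping.lookup \<alpha> h ^ q * class_indicator G x (h [^] q))"
  proof -
    have "inj_on (replicate q) ?K" using q by (auto simp: inj_on_def replicate_eq_replicate)
    moreover have "word_prod G (replicate q h) = h [^] q" if "h \<in> ?K" for h
      using that keys by (auto intro: word_prod_replicate)
    ultimately show ?thesis by (simp add: sum.reindex)
  qed
  \<comment> \<open>Fermat's theorem removes the exponent of the coefficient, so the result is again
    linear in \<open>\<alpha>\<close>.\<close>
  also have "[\<dots> = pairing (\<lambda>h. class_indicator G x (h [^] q)) \<alpha>] (mod int p)"
    unfolding pairing_def q_def
    by (intro cong_sum cong_mult int_pow_prime_power_cong [OF p]) simp
  finally show ?thesis by (simp add: q_def)
qed

text \<open>
  For large primes the congruence above forces the power map to be onto on the finite set of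
  conjugacy classes with nonzero partial augmentation.
\<close>

lemma torsion_unit_partial_augmentation_pow:
  assumes \<alpha>: "\<alpha> \<in> torsion_elements (normalized_units G)"
  obtains q :: nat where "q > 1"
    and "\<And>x. x \<in> carrier G \<Longrightarrow> partial_augmentation G \<alpha> x \<noteq> 0 \<Longrightarrow>
      \<exists>h\<in>carrier G. partial_augmentation G \<alpha> h \<noteq> 0 \<and> h [^] q \<in> conjugacy_class G x"
proof -
  interpret U: group "normalized_units G" by (rule group_normalized_units)
  let ?K = "Poly_Mapping.keys \<alpha>"
  from \<alpha> obtain n :: nat where n: "n > 0" "\<alpha> [^]\<^bsub>normalized_units G\<^esub> n = \<one>\<^bsub>normalized_units G\<^esub>"
    and \<alpha>_carrier: "\<alpha> \<in> carrier (normalized_units G)"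
    by (auto simp: torsion_elements_def)
  then have keys: "?K \<subseteq> carrier G" by (simp add: carrier_normalized_units)
  \<comment> \<open>\<open>B\<close> bounds every partial augmentation in absolute value. As
    \<open>p > n\<close>, the prime is coprime to \<open>n\<close>; as \<open>p > B\<close>, it
    divides no nonzero partial augmentation.\<close>
  define B where "B = (\<Sum>h\<in>?K. \<bar>Poly_Mapping.lookup \<alpha> h\<bar>)"
  obtain p :: nat where p: "Factorial_Ring.prime p" "p > n + nat B" using bigger_prime by blast
  \<comment> \<open>With this exponent Euler's theorem gives \<open>q \<equiv> 1\<close> modulo
    \<open>n\<close>, hence raising \<open>\<alpha>\<close> to the power \<open>q\<close> returns
    \<open>\<alpha>\<close>.\<close>
  define q where "q = p ^ totient n"
  have "\<not> p dvd n" using p n by (auto dest: dvd_imp_le)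
  then have "coprime p n" using p prime_imp_coprime by blast
  then have "[q = 1] (mod n)" unfolding q_def by (rule euler_theorem)
  have "totient n > 0" using n by simp
  then have q1: "q > 1" unfolding q_def using prime_gt_1_nat [OF p(1)] by (intro one_less_power)
  obtain m where m: "q = 1 + m * n"
    using \<open>[q = 1] (mod n)\<close> q1 by (metis cong_to_1'_nat less_zeroE not_one_less_zero mult.commute)
  have "\<alpha> [^]\<^bsub>normalized_units G\<^esub> q = \<alpha> [^]\<^bsub>normalized_units G\<^esub> (1 + n * m)"
    using m by (simp add: mult.commute)
  also have "\<dots> = \<alpha>"
    using \<alpha>_carrier n(2) by (simp del: normalized_units_simps
        add: U.nat_pow_mult [symmetric] U.nat_pow_pow [symmetric])
  finally have pow: "\<alpha> [^]\<^bsub>normalized_units G\<^esub> q = \<alpha>" .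
  have "\<exists>h\<in>carrier G. partial_augmentation G \<alpha> h \<noteq> 0 \<and> h [^] q \<in> conjugacy_class G x"
    if x: "x \<in> carrier G" "partial_augmentation G \<alpha> x \<noteq> 0" for x
  proof (rule ccontr)
    assume neg: "\<not> ?thesis"
    \<comment> \<open>By \<open>neg\<close>, on each class either this indicator or the partial
      augmentation is 0. The congruence then makes \<open>p\<close> divide the partial augmentation
      at \<open>x\<close>, against the bound \<open>B\<close>.\<close>
    have "pairing (\<lambda>h. class_indicator G x (h [^] q)) \<alpha> = 0"
    proof (rule pairing_class_function [OF keys])
      fix g h assume "g \<in> carrier G" "h \<in> conjugacy_class G g"
      then show "class_indicator G x (h [^] q) = class_indicator G x (g [^] q)"
        using x conjugacy_class_pow_cong by (simp add: class_indicator_def)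
    next
      fix g assume "g \<in> carrier G" "class_indicator G x (g [^] q) \<noteq> 0"
      then show "partial_augmentation G \<alpha> g = 0"
        using neg by (auto simp: class_indicator_def)
    qed
    then have "[partial_augmentation G \<alpha> x = 0] (mod int p)"
      using partial_augmentation_pow_cong [OF keys x(1) p(1), of "totient n"] pow
      by (simp add: q_def)
    then have "int p dvd partial_augmentation G \<alpha> x" by (simp add: cong_0_iff)
    then have "int p \<le> \<bar>partial_augmentation G \<alpha> x\<bar>"
      using dvd_imp_le_int [OF x(2), of "int p"] by simp
    moreover have "\<dots> \<le> (\<Sum>h\<in>conjugacy_class G x \<inter> ?K. \<bar>Poly_Mapping.lookup \<alpha> h\<bar>)"
      unfolding partial_augmentation_def by (rule sum_abs)
    moreover have "\<dots> \<le> B" unfolding B_def by (intro sum_mono2) auto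
    ultimately show False using p by linarith
  qed
  with q1 show thesis by (rule that)
qed

text \<open>Repeated \<open>q\<close>-th roots up to conjugacy give a backward chain
  \<open>a\<close> starting at \<open>x\<close>. All its classes meet the finite support, so
  \<open>a i\<close> and \<open>a j\<close> are conjugate for some \<open>i < j\<close>, and
  \<open>h = a j\<close>, \<open>s = q ^ j\<close>, \<open>t = q ^ (j - i)\<close> work.\<close>

lemma torsion_unit_partial_augmentation_self_pow:
  assumes \<alpha>: "\<alpha> \<in> torsion_elements (normalized_units G)"
    and x: "x \<in> carrier G" "partial_augmentation G \<alpha> x \<noteq> 0"
  obtains h and s t :: nat where "h \<in> carrier G" "s > 0" "h [^] s \<in> conjugacy_class G x"
    and "t > 1" "h [^] t \<in> conjugacy_class G h"
proof -
  let ?K = "Poly_Mapping.keys \<alpha>"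
  obtain q :: nat where q: "q > 1"
    and step: "\<And>x. x \<in> carrier G \<Longrightarrow> partial_augmentation G \<alpha> x \<noteq> 0 \<Longrightarrow>
      \<exists>h\<in>carrier G. partial_augmentation G \<alpha> h \<noteq> 0 \<and> h [^] q \<in> conjugacy_class G x"
    using torsion_unit_partial_augmentation_pow [OF \<alpha>] by metis
  let ?P = "\<lambda>y. y \<in> carrier G \<and> partial_augmentation G \<alpha> y \<noteq> 0"
  have "\<exists>a. \<forall>i. (?P (a i) \<and> (i = 0 \<longrightarrow> a i = x)) \<and> a (Suc i) [^] q \<in> conjugacy_class G (a i)"
    by (rule dependent_nat_choice) (use x step in auto)
  then obtain a where a: "\<And>i. ?P (a i)" "a 0 = x"
    and next_a: "\<And>i. a (Suc i) [^] q \<in> conjugacy_class G (a i)" by blast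
  have chain: "a (i + j) [^] (q ^ j) \<in> conjugacy_class G (a i)" for i j
  proof (induction j)
    case (Suc j)
    have "(a (i + Suc j) [^] q) [^] (q ^ j) \<in> conjugacy_class G (a (i + j) [^] (q ^ j))"
      using a next_a [of "i + j"] by (intro conjugacy_class_pow) auto
    then show ?case
      using Suc a conjugacy_class_trans by (simp add: nat_pow_pow)
  qed (use a in \<open>simp add: conjugacy_class_refl\<close>)
  have "range (\<lambda>i. conjugacy_class G (a i)) \<subseteq> conjugacy_class G ` ?K"
  proof safe
    fix i
    have "conjugacy_class G (a i) \<inter> ?K \<noteq> {}"
      using a(1) [of i] by (auto simp: partial_augmentation_def)
    then obtain h where h: "h \<in> conjugacy_class G (a i)" "h \<in> ?K" by blast
    then have "conjugacy_class G h = conjugacy_class G (a i)"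
      using a(1) [of i] conjugacy_class_eq_iff conjugacy_class_carrier by blast
    then show "conjugacy_class G (a i) \<in> conjugacy_class G ` ?K" using h by blast
  qed
  then have "finite (range (\<lambda>i. conjugacy_class G (a i)))"
    by (rule finite_subset) simp
  then have "\<not> inj (\<lambda>i. conjugacy_class G (a i))"
    using finite_imageD infinite_UNIV_nat by blast
  then obtain i j where "i \<noteq> j" "conjugacy_class G (a i) = conjugacy_class G (a j)"
    by (auto simp: inj_on_def)
  then obtain i j where ij: "i < j" "conjugacy_class G (a i) = conjugacy_class G (a j)"
    by (metis linorder_neqE_nat)
  show thesis
  proof
    show "a j \<in> carrier G" using a by blast
    show "q ^ j > 0" using q by simp
    show "a j [^] (q ^ j) \<in> conjugacy_class G x" using chain [of 0 j] a by simp
    show "q ^ (j - i) > 1" using q ij by (intro one_less_power) auto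
    show "a j [^] (q ^ (j - i)) \<in> conjugacy_class G (a j)"
      using chain [of i "j - i"] ij by simp
  qed
qed


section \<open>Elements conjugate to a proper power\<close>

text \<open>The conjugates \<open>v k\<close> of \<open>u\<close> by powers of \<open>inv z\<close>
  satisfy \<open>v (Suc k) [^] s = v k\<close>, so the cyclic groups they generate ascend inside the
  noetherian group generated by \<open>z\<close> and \<open>u\<close>. Once two consecutive ones
  agree, \<open>v (Suc k)\<close> is a power of its own \<open>s\<close>-th power.\<close>

lemma noetherian_conjugate_pow_torsion:
  assumes noeth: "locally_noetherian G"
    and u: "u \<in> carrier G" and z: "z \<in> carrier G"
    and s: "(s::nat) > 1" and conj: "z \<otimes> u \<otimes> inv z = u [^] s"
  shows "u \<in> torsion_elements G"
proof -
  define v where "v k = rec_nat u (\<lambda>_ g. inv z \<otimes> g \<otimes> z) k" for k :: nat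
  have v_0: "v 0 = u" and v_Suc: "v (Suc k) = inv z \<otimes> v k \<otimes> z" for k
    by (simp_all add: v_def)
  have v_G: "v k \<in> carrier G" for k by (induction k) (use u z in \<open>auto simp: v_0 v_Suc\<close>)
  have pow_Suc: "(inv z \<otimes> g \<otimes> z) [^] s = inv z \<otimes> g [^] s \<otimes> z" if "g \<in> carrier G" for g
    using conjugate_pow [of "inv z" g s] z that by simp
  have root: "v (Suc k) [^] s = v k" for k
  proof (induction k)
    case 0
    have "v (Suc 0) [^] s = inv z \<otimes> (z \<otimes> u \<otimes> inv z) \<otimes> z"
      using u by (simp add: v_0 v_Suc pow_Suc conj)
    also have "\<dots> = u"
      using u z by (simp add: m_assoc inv_mult_cancel)
    finally show ?case by (simp add: v_0)
  next
    case (Suc k)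
    then show ?case using v_G by (simp add: v_Suc [of "Suc k"] pow_Suc) (simp add: v_Suc)
  qed
  have root_pow: "v k [^] (s ^ k) = u" for k
  proof (induction k)
    case (Suc k)
    have "v (Suc k) [^] (s ^ Suc k) = (v (Suc k) [^] s) [^] (s ^ k)"
      using v_G by (simp add: nat_pow_pow)
    then show ?case using Suc root by simp
  qed (simp add: v_0 u)
  define L where "L = generate G {z, u}"
  have L: "subgroup L G" unfolding L_def using u z by (intro generate_is_subgroup) auto
  have zu_L: "z \<in> L" "u \<in> L" by (auto simp: L_def intro: generate.incl)
  have v_L: "v k \<in> L" for k
    by (induction k) (use zu_L L in \<open>auto simp: v_0 v_Suc subgroup.m_closed subgroup.m_inv_closed\<close>)
  have "noetherian_group (G\<lparr>carrier := L\<rparr>)"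
    using noeth u z unfolding locally_noetherian_def L_def by auto
  \<comment> \<open>The cyclic groups are generated in \<open>G\<close>; the maximal condition needs
    them as subgroups of \<open>L\<close>.\<close>
  moreover have "range (\<lambda>k. generate G {v k}) \<subseteq> {K. subgroup K (G\<lparr>carrier := L\<rparr>)}"
  proof safe
    fix k
    show "subgroup (generate G {v k}) (G\<lparr>carrier := L\<rparr>)"
      using v_L v_G L by (intro subgroup_incl generate_is_subgroup generate_subgroup_incl) auto
  qed
  ultimately have "\<exists>M\<in>range (\<lambda>k. generate G {v k}).
      \<forall>K\<in>range (\<lambda>k. generate G {v k}). M \<subseteq> K \<longrightarrow> K = M"
    unfolding noetherian_group_def by blast
  then have "\<exists>k. \<forall>j. generate G {v k} \<subseteq> generate G {v j} \<longrightarrow> generate G {v j} = generate G {v k}"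
    by simp
  then obtain k where
    k: "\<forall>j. generate G {v k} \<subseteq> generate G {v j} \<longrightarrow> generate G {v j} = generate G {v k}" ..
  have "v k \<in> generate G {v (Suc k)}"
  proof -
    have "v k = v (Suc k) [^] int s" using root [of k] by (simp add: int_pow_int)
    then show ?thesis using generate_pow [OF v_G [of "Suc k"]] by blast
  qed
  then have "generate G {v k} \<subseteq> generate G {v (Suc k)}"
    using v_G by (intro generate_subgroup_incl generate_is_subgroup) auto
  then have "generate G {v (Suc k)} = generate G {v k}" using k by simp
  then have "v (Suc k) \<in> generate G {v k}" using generate.incl [of "v (Suc k)" "{v (Suc k)}" G] by simp
  then obtain i :: int where "v (Suc k) = v k [^] i" using generate_pow v_G by auto
  also have "v k = v (Suc k) [^] int s" using root [of k] by (simp add: int_pow_int)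
  finally have "v (Suc k) [^] (1::int) = v (Suc k) [^] (int s * i)"
    using v_G by (simp add: int_pow_pow)
  \<comment> \<open>As \<open>s > 1\<close> does not divide 1, two different exponents give the same
    power of \<open>v (Suc k)\<close>, whose order is therefore finite.\<close>
  moreover have "1 \<noteq> int s * i"
    using s by (metis of_nat_1 of_nat_dvd_iff dvd_triv_left nat_dvd_1_iff_1 less_irrefl)
  ultimately have "ord (v (Suc k)) \<noteq> 0"
    using v_G int_pow_eq by (metis cong_iff_dvd_diff eq_iff_diff_eq_0 dvd_0_left of_nat_0 int_pow_eq)
  then have "v (Suc k) \<in> torsion_elements G" using v_G torsion_elements_iff_ord by blast
  then have "v (Suc k) [^] (s ^ Suc k) \<in> torsion_elements G"
    using v_G s by (subst torsion_elements_pow_iff) auto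
  then show ?thesis unfolding root_pow .
qed

text \<open>Conjugation by \<open>y\<close> is a homomorphism, so each iteration applies the
  \<open>t\<close>-th power map once more. This lets \<open>y\<close> be replaced by a power of it
  lying in the normal subgroup.\<close>

lemma conjugate_iterate_pow:
  assumes "x \<in> carrier G" "y \<in> carrier G" "y \<otimes> x \<otimes> inv y = x [^] (t::nat)"
  shows "y [^] (n::nat) \<otimes> x \<otimes> inv (y [^] n) = x [^] (t ^ n)"
proof (induction n)
  case (Suc n)
  have "y [^] Suc n \<otimes> x \<otimes> inv (y [^] Suc n) = y [^] n \<otimes> (y \<otimes> x \<otimes> inv y) \<otimes> inv (y [^] n)"
    using assms(1,2) by (simp add: m_assoc inv_mult_group)
  also have "\<dots> = (y [^] n \<otimes> x \<otimes> inv (y [^] n)) [^] t"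
    using assms by (simp add: conjugate_pow)
  also have "\<dots> = x [^] (t ^ Suc n)"
    using assms(1) by (simp add: Suc nat_pow_pow mult.commute)
  finally show ?case .
qed (use assms in simp)

end

section \<open>Passage to a normal subgroup of finite index\<close>

lemma torsion_elements_subgroup:
  "H \<subseteq> carrier G \<Longrightarrow> torsion_elements (G\<lparr>carrier := H\<rparr>) = torsion_elements G \<inter> H"
  by (auto simp: torsion_elements_def nat_pow_def)

context normal
begin

text \<open>Normality turns right cosets into left cosets, for which this is the usual
  criterion.\<close>

lemma r_coset_eq_iff:
  assumes "x \<in> carrier G" "y \<in> carrier G"
  shows "H #> x = H #> y \<longleftrightarrow> inv x \<otimes> y \<in> H"
proof
  assume "H #> x = H #> y"
  then have "x <# H = y <# H" using assms coset_eq by simp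
  moreover have "y \<in> y <# H" using assms one_closed by (auto simp: l_coset_def intro!: bexI [of _ \<one>])
  ultimately obtain h where "h \<in> H" "y = x \<otimes> h" by (auto simp: l_coset_def)
  then show "inv x \<otimes> y \<in> H" using assms by (simp add: m_assoc [symmetric])
next
  assume "inv x \<otimes> y \<in> H"
  then have "x \<otimes> (inv x \<otimes> y) \<in> x <# H" by (auto simp: l_coset_def)
  then have "y \<in> H #> x" using assms coset_eq by (simp add: m_assoc [symmetric])
  then show "H #> x = H #> y" using assms repr_independence is_subgroup by blast
qed

text \<open>Lagrange's theorem in \<open>G Mod H\<close>, whose order is the index.\<close>

lemma pow_index_closed:
  assumes "finite (rcosets H)" "x \<in> carrier G"
  shows "x [^] card (rcosets H) \<in> H"
proof -
  interpret Q: group "G Mod H" by (rule factorgroup_is_group)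
  have x: "H #> x \<in> carrier (G Mod H)" using assms(2) by (auto simp: FactGroup_def RCOSETS_def)
  have "H #> (x [^] card (rcosets H)) = (H #> x) [^]\<^bsub>G Mod H\<^esub> card (rcosets H)"
    using r_coset_hom_Mod assms(2) is_group Q.is_group by (rule hom_nat_pow)
  also have "\<dots> = \<one>\<^bsub>G Mod H\<^esub>"
    using Q.pow_order_eq_1 [OF x] by (simp add: order_def FactGroup_def)
  finally show ?thesis
    using assms(2) coset_join1 [OF _ _ is_subgroup] by (simp add: FactGroup_def)
qed

text \<open>
  Raising both the element and the conjugating element to the index moves a relation
  \<open>y h y\<^sup>-\<^sup>1 = h\<^sup>t\<close> into \<open>H\<close>.
\<close>

lemma torsion_unit_partial_augmentation_torsion:
  assumes "locally_noetherian (G\<lparr>carrier := H\<rparr>)" "finite (rcosets H)"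
    and "\<alpha> \<in> torsion_elements (normalized_units G)"
    and x: "x \<in> carrier G" "partial_augmentation G \<alpha> x \<noteq> 0"
  shows "x \<in> torsion_elements G"
proof -
  interpret S: group "G\<lparr>carrier := H\<rparr>" by (rule subgroup_is_group [OF is_group])
  obtain h and s t :: nat where h: "h \<in> carrier G" "s > 0" "h [^] s \<in> conjugacy_class G x"
    and t: "t > 1" "h [^] t \<in> conjugacy_class G h"
    using torsion_unit_partial_augmentation_self_pow [OF assms(3) x] .
  from t(2) obtain y where y: "y \<in> carrier G" "y \<otimes> h \<otimes> inv y = h [^] t"
    by (auto simp: conjugacy_class_def)
  define N where "N = card (rcosets H)"
  have "rcosets H \<noteq> {}" by (auto simp: RCOSETS_def)
  then have N: "N > 0" using assms(2) by (simp add: N_def card_gt_0_iff)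
  have in_H: "h [^] N \<in> H" "y [^] N \<in> H"
    using pow_index_closed assms(2) h y by (simp_all add: N_def)
  \<comment> \<open>Conjugation commutes with taking \<open>N\<close>-th powers, and conjugation by
    \<open>y [^] N\<close> applies the \<open>t\<close>-th power map to \<open>h\<close> exactly
    \<open>N\<close> times. Since \<open>N > 0\<close>, the exponent \<open>t ^ N\<close> still
    exceeds 1.\<close>
  have "y [^] N \<otimes> h [^] N \<otimes> inv (y [^] N) = (h [^] N) [^] (t ^ N)"
  proof -
    have "y [^] N \<otimes> h [^] N \<otimes> inv (y [^] N) = (y [^] N \<otimes> h \<otimes> inv (y [^] N)) [^] N"
      using h y by (simp add: conjugate_pow)
    also have "\<dots> = (h [^] N) [^] (t ^ N)"
      using h y by (simp add: conjugate_iterate_pow nat_pow_pow mult.commute)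
    finally show ?thesis .
  qed
  then have "h [^] N \<in> torsion_elements (G\<lparr>carrier := H\<rparr>)"
    using in_H one_less_power [OF t(1) N] assms(1)
    by (intro S.noetherian_conjugate_pow_torsion [where z = "y [^] N" and s = "t ^ N"])
      (auto simp: m_inv_consistent [OF is_subgroup] nat_pow_consistent [symmetric])
  \<comment> \<open>Torsion now passes from \<open>h [^] N\<close> to \<open>h\<close>, then to
    \<open>h [^] s\<close> and its conjugate \<open>x\<close>.\<close>
  then have "h [^] N \<in> torsion_elements G" by (simp add: torsion_elements_subgroup subset)
  then have "h [^] s \<in> torsion_elements G"
    using h N by (simp add: torsion_elements_pow_iff)
  then show ?thesis using conjugacy_class_torsion x h by blast
qed

end

section \<open>Lifting the unique trace property from the quotient\<close>

lemma hom_conjugacy_class: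
  assumes "group G" "group K" "f \<in> hom G K" "g \<in> carrier G" "h \<in> conjugacy_class G g"
  shows "f h \<in> conjugacy_class K (f g)"
proof -
  interpret group_hom G K f using assms by (simp add: group_hom_def group_hom_axioms_def)
  show ?thesis using assms(4,5) by (auto simp: conjugacy_class_def)
qed

theorem theorem3p1:
  fixes G :: "('a, 'b) monoid_scheme" and H :: "'a set"
  assumes "group G"
    and "H \<lhd> G"
    and "locally_noetherian (G\<lparr>carrier := H\<rparr>)"
    and "torsion_free (G\<lparr>carrier := H\<rparr>)"
    and "finite (rcosets\<^bsub>G\<^esub> H)"
    and "subgroup (torsion_elements G) G"
    and "UT_group (G Mod H)"
  shows "UT_group G"
proof -
  interpret normal H G by fact
  interpret Q: group "G Mod H" by (rule factorgroup_is_group)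
  let ?Q = "G Mod H"
  define \<pi> where "\<pi> g = H #>\<^bsub>G\<^esub> g" for g
  have \<pi>: "\<pi> \<in> hom G ?Q" unfolding \<pi>_def by (rule r_coset_hom_Mod)
  then have \<pi>_closed: "\<pi> g \<in> carrier ?Q" if "g \<in> carrier G" for g
    using that by (auto simp: hom_def)
  have \<pi>_onto: "\<exists>g\<in>carrier G. C = \<pi> g" if "C \<in> carrier ?Q" for C
    using that by (auto simp: FactGroup_def RCOSETS_def \<pi>_def)
  have \<pi>_conj: "\<pi> h \<in> conjugacy_class ?Q (\<pi> g)" if "g \<in> carrier G" "h \<in> conjugacy_class G g" for g h
    using hom_conjugacy_class [OF is_group Q.is_group \<pi> that] .
  have \<pi>_class: "\<pi> h \<in> conjugacy_class ?Q C \<longleftrightarrow> \<pi> g \<in> conjugacy_class ?Q C"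
    if "g \<in> carrier G" "h \<in> conjugacy_class G g" "C \<in> carrier ?Q" for g h C
    using \<pi>_conj [OF that(1,2)] \<pi>_closed that by (intro Q.conjugacy_class_mem_cong)
  have T_H: "g = \<one>\<^bsub>G\<^esub>" if "g \<in> torsion_elements G" "g \<in> H" for g
    using assms(4) that by (auto simp: torsion_free_def torsion_elements_subgroup subset)
  have torsion_conj: "h \<in> conjugacy_class G g"
    if g: "g \<in> torsion_elements G" and h: "h \<in> torsion_elements G"
      and gh: "\<pi> h \<in> conjugacy_class ?Q (\<pi> g)" for g h
  proof -
    have gG: "g \<in> carrier G" and hG: "h \<in> carrier G"
      using g h by (auto simp: torsion_elements_def)
    from gh obtain C where C: "C \<in> carrier ?Q" "\<pi> h = C \<otimes>\<^bsub>?Q\<^esub> \<pi> g \<otimes>\<^bsub>?Q\<^esub> inv\<^bsub>?Q\<^esub> C"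
      by (auto simp: conjugacy_class_def)
    then obtain x where x: "x \<in> carrier G" "C = \<pi> x" using \<pi>_onto by blast
    interpret \<pi>: group_hom G ?Q \<pi>
      using \<pi> is_group Q.is_group by (simp add: group_hom_def group_hom_axioms_def)
    \<comment> \<open>The conjugating coset is lifted to \<open>x\<close>. Then
      \<open>inv ?g \<otimes> h\<close> lies in \<open>H\<close>, and it is torsion because the
      torsion elements form a subgroup; torsion-freeness of \<open>H\<close> makes it
      trivial.\<close>
    let ?g = "x \<otimes>\<^bsub>G\<^esub> g \<otimes>\<^bsub>G\<^esub> inv\<^bsub>G\<^esub> x"
    have conj: "?g \<in> conjugacy_class G g" using x by (auto simp: conjugacy_class_def)
    then have "?g \<in> torsion_elements G"
      using g gG conjugacy_class_torsion conjugacy_class_sym conjugacy_class_carrier by blast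
    then have "inv\<^bsub>G\<^esub> ?g \<otimes>\<^bsub>G\<^esub> h \<in> torsion_elements G"
      using h assms(6) by (simp add: subgroup.m_closed subgroup.m_inv_closed)
    moreover have "inv\<^bsub>G\<^esub> ?g \<otimes>\<^bsub>G\<^esub> h \<in> H"
      using r_coset_eq_iff [of ?g h] C x gG hG by (simp flip: \<pi>_def)
    ultimately have "inv\<^bsub>G\<^esub> ?g \<otimes>\<^bsub>G\<^esub> h = \<one>\<^bsub>G\<^esub>" by (rule T_H)
    then have "h = ?g" using x gG hG by (metis inv_closed inv_equality inv_inv m_closed)
    with conj show ?thesis by simp
  qed
  have "unique_trace G \<alpha>" if \<alpha>: "\<alpha> \<in> torsion_elements (normalized_units G)" for \<alpha>
  proof -
    let ?\<beta> = "group_ring_map \<pi> \<alpha>"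
    have keys: "Poly_Mapping.keys \<alpha> \<subseteq> carrier G"
      using \<alpha> by (auto simp: torsion_elements_def carrier_normalized_units)
    have torsion: "g \<in> torsion_elements G"
      if "g \<in> carrier G" "partial_augmentation G \<alpha> g \<noteq> 0" for g
      using torsion_unit_partial_augmentation_torsion [OF assms(3,5) \<alpha> that] .
    have "?\<beta> \<in> torsion_elements (normalized_units ?Q)"
      using hom_torsion_elements [OF group_normalized_units Q.group_normalized_units
          group_ring_map_normalized_units [OF is_group Q.is_group \<pi>] \<alpha>] .
    then have "unique_trace ?Q ?\<beta>" using assms(7) by (simp add: UT_group_def)
    then obtain C where C: "C \<in> carrier ?Q" "partial_augmentation ?Q ?\<beta> C \<noteq> 0"
      and C_unique: "\<And>D. D \<in> carrier ?Q \<Longrightarrow> partial_augmentation ?Q ?\<beta> D \<noteq> 0 \<Longrightarrow>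
        D \<in> conjugacy_class ?Q C"
      unfolding unique_trace_def by blast
    have aug_\<beta>: "partial_augmentation ?Q ?\<beta> D = pairing (\<lambda>h. class_indicator ?Q D (\<pi> h)) \<alpha>" for D
      by (simp add: partial_augmentation_eq_pairing pairing_group_ring_map o_def)
    \<comment> \<open>The preimage of a class of the quotient may be a union of several classes of
      \<open>G\<close>. By \<open>torsion_conj\<close> the two indicators agree at torsion elements,
      and elsewhere the partial augmentation of \<open>\<alpha>\<close> is 0.\<close>
    have aug_eq: "partial_augmentation ?Q ?\<beta> (\<pi> g) = partial_augmentation G \<alpha> g"
      if g: "g \<in> torsion_elements G" for g
    proof -
      have gG: "g \<in> carrier G" using g by (simp add: torsion_elements_def)
      have "pairing (\<lambda>h. class_indicator ?Q (\<pi> g) (\<pi> h) - class_indicator G g h) \<alpha> = 0"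
      proof (rule pairing_class_function [OF keys])
        fix k h assume kh: "k \<in> carrier G" "h \<in> conjugacy_class G k"
        then have "h \<in> conjugacy_class G g \<longleftrightarrow> k \<in> conjugacy_class G g"
          using gG by (intro conjugacy_class_mem_cong)
        then show "class_indicator ?Q (\<pi> g) (\<pi> h) - class_indicator G g h =
            class_indicator ?Q (\<pi> g) (\<pi> k) - class_indicator G g k"
          using \<pi>_class [OF kh \<pi>_closed [OF gG]] by (simp add: class_indicator_def)
      next
        fix k assume k: "k \<in> carrier G"
          "class_indicator ?Q (\<pi> g) (\<pi> k) - class_indicator G g k \<noteq> 0"
        show "partial_augmentation G \<alpha> k = 0"
        proof (rule ccontr)
          assume "partial_augmentation G \<alpha> k \<noteq> 0"
          then have "k \<in> torsion_elements G" using torsion k by blast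
          then have "\<pi> k \<in> conjugacy_class ?Q (\<pi> g) \<longleftrightarrow> k \<in> conjugacy_class G g"
            using torsion_conj g \<pi>_conj gG by blast
          then show False using k(2) by (simp add: class_indicator_def)
        qed
      qed
      then show ?thesis
        unfolding aug_\<beta> by (simp add: partial_augmentation_eq_pairing pairing_fun_diff)
    qed
    \<comment> \<open>If all partial augmentations of \<open>\<alpha>\<close> vanished, so would its
      pairing with every class function, including the one that computes the nonzero value at
      \<open>C\<close>.\<close>
    have "\<exists>g\<in>carrier G. partial_augmentation G \<alpha> g \<noteq> 0"
    proof (rule ccontr)
      assume "\<not> ?thesis"
      then have "pairing (\<lambda>h. class_indicator ?Q C (\<pi> h)) \<alpha> = 0"
        by (intro pairing_class_function [OF keys]) (auto simp: class_indicator_def \<pi>_class C)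
      then show False using C by (simp add: aug_\<beta>)
    qed
    then obtain g where g: "g \<in> carrier G" "partial_augmentation G \<alpha> g \<noteq> 0" by blast
    \<comment> \<open>By \<open>aug_eq\<close> the images of \<open>g\<close> and \<open>h\<close>
      keep nonzero partial augmentations, so both lie in the class of \<open>C\<close>;
      \<open>torsion_conj\<close> lifts their conjugacy to \<open>G\<close>.\<close>
    have "h \<in> conjugacy_class G g" if h: "h \<in> carrier G" "partial_augmentation G \<alpha> h \<noteq> 0" for h
    proof -
      have "\<pi> k \<in> conjugacy_class ?Q C"
        if "k \<in> carrier G" "partial_augmentation G \<alpha> k \<noteq> 0" for k
        using C_unique [of "\<pi> k"] aug_eq torsion that \<pi>_closed by auto
      then have "\<pi> h \<in> conjugacy_class ?Q (\<pi> g)"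
        using g h C \<pi>_closed Q.conjugacy_class_mem_cong [of C "\<pi> g" "\<pi> h"]
          Q.conjugacy_class_sym [of C "\<pi> g"] by simp
      then show ?thesis using torsion_conj torsion g h by blast
    qed
    with g show ?thesis unfolding unique_trace_def by blast
  qed
  with is_group show ?thesis by (simp add: UT_group_def)
qed

end
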